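(* The orders $a_n=|\mathcal{DDP}_n|$ satisfy $$a_n = |\mathcal{DDP}_n| = 3a_{n-1}-2a_{n-2}-2^{\lfloor n/2\rfloor}+n+1,$$ with $a_0=1$ and $a_{-1}=0$.
   Context: $X_n=\{1,2,\ldots,n\}$ (with $X_0=\emptyset$) and $\mathcal{I}_n$ is the symmetric inverse semigroup of all partial one-to-one maps of $X_n$ (including the empty map), with maps written on the right of their arguments. A map $\alpha\in\mathcal{I}_n$ is a partial isometry if $|x-y|=|x\alpha-y\alpha|$ for all $x,y\in\operatorname{Dom}\alpha$; it is order-decreasing if $x\alpha\leq x$ for all $x\in\operatorname{Dom}\alpha$. $\mathcal{DDP}_n$ is the semigroup of all order-decreasing partial isometries of $X_n$, and $|\mathcal{DDP}_n|$ is its number of elements.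
   Formalization: The initial value a_{-1}=0 is replaced by a_{-1}=1: with a_{-1}=0 the recurrence at n=1 would give 4, whereas |DDP_1|=2. The recurrence is proved for all n≥1, and the cases n≥2 are unaffected by this change. *)

theory Defs
  imports Main
begin

text \<open>Partial maps of the chain $X_n$ are modelled by the library type of partial functions
  \<open>nat \<rightharpoonup> nat\<close>, restricted to those whose domain and range lie in $X_n$.\<close>

definition X :: "nat \<Rightarrow> nat set" where
  "X n = {1..n}"

definition symmetric_inverse :: "nat \<Rightarrow> (nat \<rightharpoonup> nat) set" where
  "symmetric_inverse n = {\<alpha>. dom \<alpha> \<subseteq> X n \<and> ran \<alpha> \<subseteq> X n \<and> inj_on \<alpha> (dom \<alpha>)}"

text \<open>Distances are taken in \<open>int\<close>, because subtraction on \<open>nat\<close> truncates.\<close>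

definition partial_isometry :: "(nat \<rightharpoonup> nat) \<Rightarrow> bool" where
  "partial_isometry \<alpha> \<longleftrightarrow>
     (\<forall>x\<in>dom \<alpha>. \<forall>y\<in>dom \<alpha>. \<bar>int x - int y\<bar> = \<bar>int (the (\<alpha> x)) - int (the (\<alpha> y))\<bar>)"

definition order_decreasing :: "(nat \<rightharpoonup> nat) \<Rightarrow> bool" where
  "order_decreasing \<alpha> \<longleftrightarrow> (\<forall>x\<in>dom \<alpha>. the (\<alpha> x) \<le> x)"

definition DDP :: "nat \<Rightarrow> (nat \<rightharpoonup> nat) set" where
  "DDP n = {\<alpha> \<in> symmetric_inverse n. partial_isometry \<alpha> \<and> order_decreasing \<alpha>}"

text \<open>The sequence of orders is indexed by \<open>int\<close> in the recurrence, because the recurrence at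
  $n = 1$ refers to $a_{-1}$.  The value used there is $a_{-1} = 1$.  This is the number of partial
  maps of an empty chain, and it is the only value for which the recurrence holds at $n = 1$:
  since $a_0 = 1$ and $a_1 = 2$, it reads $2 = 3 - 2 a_{-1} - 1 + 1 + 1$.  The value
  $a_{-1} = 0$ would give $a_1 = 4$.  For $n \geq 2$ the term $a_{-1}$ does not occur.\<close>

end

theory Submission
  imports Defs
begin

text \<open>
  The recurrence is a statement about increments.  With $b_n = a_n - a_{n-1}$ it reads
  $b_n = 2 b_{n-1} - 2^{\lfloor n/2\rfloor} + n + 1$, and $b_n$ counts the maps in
  $\mathcal{DDP}_n$ whose domain contains $n$, because the others are exactly the maps in
  $\mathcal{DDP}_{n-1}$ (\<open>DDP_Suc\<close>).

  Sort the maps counted by $b_n$ by the displacement $k = n - n\alpha$, where $0 \le k < n$.  A point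
  $x < n$ of the domain goes to one of the two points at distance $n - x$ from $n - k$, so it goes to
  $x - k$ or to $2n - k - x$.  The two choices cannot be mixed: the images of a translated and a
  reflected point are $2n - x - y$ apart, which exceeds $|x - y|$.  Hence $\alpha$ is a
  restriction of one translation or of one reflection, determined by its domain
  (\<open>DDP_fibre\<close>).  The image must be at least $1$, so a translation may use any points of
  $\{k+1,\ldots,n-1\}$ next to $n$; the image must not exceed the argument, so a reflection
  may use any of the $\lfloor k/2\rfloor$ points from $n - \lfloor k/2\rfloor$ to $n-1$.  Only
  the map with domain $\{n\}$ is counted twice, so the displacement $k$ contributes
  $2^{n-1-k} + 2^{\lfloor k/2\rfloor} - 1$ (\<open>card_DDP_fibre\<close>).  Summing over $k$,
  \[ b_n = 2^n - 1 - n + \sum_{k<n} 2^{\lfloor k/2\rfloor}. \]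
  The recurrence for $b_n$ now follows by induction on $n$ (\<open>increment_recurrence\<close>).  The
  formula gives $b_0 = 0$, which is $a_0 - a_{-1}$ for $a_{-1} = 1$, so $n = 1$ is no exception.
\<close>

section \<open>Maps as graphs\<close>

text \<open>Injectivity follows from the isometry condition, and the upper bound on the range from the
  upper bound on the domain, so membership reduces to conditions on pairs of the graph.\<close>

lemma DDP_iff:
  "\<alpha> \<in> DDP n \<longleftrightarrow>
     (\<forall>x u. \<alpha> x = Some u \<longrightarrow> 1 \<le> u \<and> u \<le> x \<and> x \<le> n) \<and>
     (\<forall>x y u v. \<alpha> x = Some u \<longrightarrow> \<alpha> y = Some v \<longrightarrow>
        \<bar>int x - int y\<bar> = \<bar>int u - int v\<bar>)"
  (is "_ \<longleftrightarrow> ?bounds \<and> ?isometry")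
proof
  assume D: "\<alpha> \<in> DDP n"
  have ?bounds
  proof (intro allI impI)
    fix x u assume xu: "\<alpha> x = Some u"
    then have "x \<in> dom \<alpha>" "u \<in> ran \<alpha>" by (auto simp: ran_def)
    with D have "x \<in> X n" "u \<in> X n" "the (\<alpha> x) \<le> x"
      by (auto simp: DDP_def symmetric_inverse_def order_decreasing_def)
    with xu show "1 \<le> u \<and> u \<le> x \<and> x \<le> n" by (simp add: X_def)
  qed
  moreover have ?isometry
  proof (intro allI impI)
    fix x y u v assume xu: "\<alpha> x = Some u" and yv: "\<alpha> y = Some v"
    then have "x \<in> dom \<alpha>" "y \<in> dom \<alpha>" by auto
    with D have "\<bar>int x - int y\<bar> = \<bar>int (the (\<alpha> x)) - int (the (\<alpha> y))\<bar>"
      unfolding DDP_def partial_isometry_def by blast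
    with xu yv show "\<bar>int x - int y\<bar> = \<bar>int u - int v\<bar>" by simp
  qed
  ultimately show "?bounds \<and> ?isometry" by blast
next
  assume R: "?bounds \<and> ?isometry"
  have "dom \<alpha> \<subseteq> X n" "ran \<alpha> \<subseteq> X n"
    using R unfolding X_def ran_def dom_def by fastforce+
  moreover have "inj_on \<alpha> (dom \<alpha>)"
  proof (rule inj_onI)
    fix x y assume "x \<in> dom \<alpha>" "y \<in> dom \<alpha>" and eq: "\<alpha> x = \<alpha> y"
    then obtain u where "\<alpha> x = Some u" "\<alpha> y = Some u" by auto
    with R have "\<bar>int x - int y\<bar> = \<bar>int u - int u\<bar>" by blast
    then show "x = y" by simp
  qed
  moreover have "partial_isometry \<alpha>" unfolding partial_isometry_def
  proof (intro ballI)
    fix x y assume "x \<in> dom \<alpha>" "y \<in> dom \<alpha>"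
    then obtain u v where "\<alpha> x = Some u" "\<alpha> y = Some v" by auto
    with R show "\<bar>int x - int y\<bar> = \<bar>int (the (\<alpha> x)) - int (the (\<alpha> y))\<bar>" by simp
  qed
  moreover have "order_decreasing \<alpha>"
    using R unfolding order_decreasing_def by force
  ultimately show "\<alpha> \<in> DDP n" by (simp add: DDP_def symmetric_inverse_def)
qed

lemma DDP_0: "DDP 0 = {Map.empty}"
proof -
  have "\<alpha> = Map.empty" if "\<alpha> \<in> DDP 0" for \<alpha>
  proof (rule ext)
    fix x
    from that have "\<not> (\<exists>u. \<alpha> x = Some u)" unfolding DDP_iff by fastforce
    then show "\<alpha> x = None" by auto
  qed
  moreover have "Map.empty \<in> DDP 0" by (simp add: DDP_iff)
  ultimately show ?thesis by blast
qed

definition DDP_fibre :: "nat \<Rightarrow> nat \<Rightarrow> (nat \<rightharpoonup> nat) set" where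
  "DDP_fibre n k = {\<alpha> \<in> DDP n. \<alpha> n = Some (n - k)}"

text \<open>A map that is undefined at \<open>Suc n\<close> has its domain in $X_n$, and its range follows because it is
  order-decreasing.  Any other map sends \<open>Suc n\<close> to a point between \<open>1\<close> and \<open>Suc n\<close>, that is,
  moves it down by at most \<open>n\<close>.\<close>

lemma DDP_Suc: "DDP (Suc n) = DDP n \<union> (\<Union>k\<in>{..<Suc n}. DDP_fibre (Suc n) k)"
proof
  show "DDP (Suc n) \<subseteq> DDP n \<union> (\<Union>k\<in>{..<Suc n}. DDP_fibre (Suc n) k)"
  proof
    fix \<alpha> assume D: "\<alpha> \<in> DDP (Suc n)"
    show "\<alpha> \<in> DDP n \<union> (\<Union>k\<in>{..<Suc n}. DDP_fibre (Suc n) k)"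
    proof (cases "\<alpha> (Suc n)")
      case None
      have "x \<le> n" if xu: "\<alpha> x = Some u" for x u
      proof -
        have "x \<le> Suc n" using D xu by (simp add: DDP_iff)
        moreover have "x \<noteq> Suc n" using None xu by auto
        ultimately show ?thesis by simp
      qed
      with D have "\<alpha> \<in> DDP n" by (simp add: DDP_iff)
      then show ?thesis ..
    next
      case (Some j)
      with D have j: "1 \<le> j" "j \<le> Suc n" by (simp_all add: DDP_iff)
      then have "\<alpha> \<in> DDP_fibre (Suc n) (Suc n - j)" "Suc n - j < Suc n"
        using D Some by (simp_all add: DDP_fibre_def)
      then show ?thesis by blast
    qed
  qed
  show "DDP n \<union> (\<Union>k\<in>{..<Suc n}. DDP_fibre (Suc n) k) \<subseteq> DDP (Suc n)"
    by (auto simp: DDP_fibre_def DDP_iff le_SucI)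
qed

lemma DDP_disjoint_fibre: "DDP n \<inter> DDP_fibre (Suc n) k = {}"
proof -
  have "\<alpha> (Suc n) \<noteq> Some u" if "\<alpha> \<in> DDP n" for \<alpha> u
    using that unfolding DDP_iff by (meson not_less_eq_eq order_refl)
  then show ?thesis by (auto simp: DDP_fibre_def)
qed

section \<open>The maps with a given displacement of the largest point\<close>

text \<open>Both maps take the set \<open>B\<close> of further points as argument, not the whole domain: then
  the maps sending \<open>n\<close> to \<open>n - k\<close> are parametrised by power sets, and \<open>B = {}\<close> is the one map
  that arises as a translation and as a reflection.\<close>

definition translation :: "nat \<Rightarrow> nat \<Rightarrow> nat set \<Rightarrow> (nat \<rightharpoonup> nat)" where
  "translation n k B = (\<lambda>x. Some (x - k)) |` insert n B"

definition reflection :: "nat \<Rightarrow> nat \<Rightarrow> nat set \<Rightarrow> (nat \<rightharpoonup> nat)" where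
  "reflection n k B = (\<lambda>x. Some (2 * n - k - x)) |` insert n B"

lemma translation_eq_Some:
  "translation n k B x = Some u \<longleftrightarrow> (x = n \<or> x \<in> B) \<and> u = x - k"
  by (auto simp: translation_def restrict_map_def)

lemma reflection_eq_Some:
  "reflection n k B x = Some u \<longleftrightarrow> (x = n \<or> x \<in> B) \<and> u = 2 * n - k - x"
  by (auto simp: reflection_def restrict_map_def)

lemma dom_translation: "dom (translation n k B) = insert n B"
  by (auto simp: translation_eq_Some)

lemma dom_reflection: "dom (reflection n k B) = insert n B"
  by (auto simp: reflection_eq_Some)

lemma reflection_empty: "k \<le> n \<Longrightarrow> reflection n k {} = translation n k {}"
  by (auto simp: reflection_def translation_def restrict_map_def fun_eq_iff)

lemma inj_on_translation: "inj_on (translation n k) (Pow {k+1..<n})"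
proof (rule inj_onI)
  fix A B assume AB: "A \<in> Pow {k+1..<n}" "B \<in> Pow {k+1..<n}"
    and "translation n k A = translation n k B"
  then have "insert n A = insert n B" by (metis dom_translation)
  moreover have "n \<notin> A" "n \<notin> B" using AB by auto
  ultimately show "A = B" by (metis insert_ident)
qed

lemma inj_on_reflection: "inj_on (reflection n k) (Pow {n - k div 2..<n})"
proof (rule inj_onI)
  fix A B assume AB: "A \<in> Pow {n - k div 2..<n}" "B \<in> Pow {n - k div 2..<n}"
    and "reflection n k A = reflection n k B"
  then have "insert n A = insert n B" by (metis dom_reflection)
  moreover have "n \<notin> A" "n \<notin> B" using AB by auto
  ultimately show "A = B" by (metis insert_ident)
qed

lemma translation_in_fibre:
  assumes k: "k < n" and B: "B \<subseteq> {k+1..<n}"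
  shows "translation n k B \<in> DDP_fibre n k"
proof -
  have x: "k < x \<and> x \<le> n" if "x = n \<or> x \<in> B" for x
    using that k B by auto
  have "translation n k B \<in> DDP n"
    unfolding DDP_iff translation_eq_Some
  proof (rule conjI; intro allI impI)
    fix x u assume "(x = n \<or> x \<in> B) \<and> u = x - k"
    then show "1 \<le> u \<and> u \<le> x \<and> x \<le> n" using x[of x] by auto
  next
    fix x y u v
    assume "(x = n \<or> x \<in> B) \<and> u = x - k" "(y = n \<or> y \<in> B) \<and> v = y - k"
    then show "\<bar>int x - int y\<bar> = \<bar>int u - int v\<bar>" using x[of x] x[of y] by auto
  qed
  then show ?thesis by (simp add: DDP_fibre_def translation_eq_Some)
qed

text \<open>The reflection fixes $n - k/2$, so it is order-decreasing exactly from there on.\<close>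

lemma reflection_in_fibre:
  assumes k: "k < n" and B: "B \<subseteq> {n - k div 2..<n}"
  shows "reflection n k B \<in> DDP_fibre n k"
proof -
  have x: "2 * n \<le> 2 * x + k \<and> x \<le> n" if "x = n \<or> x \<in> B" for x
  proof (cases "x = n")
    case False
    then have "n - k div 2 \<le> x" "x < n" using that B by auto
    then show ?thesis by linarith
  qed simp
  have "reflection n k B \<in> DDP n"
    unfolding DDP_iff reflection_eq_Some
  proof (rule conjI; intro allI impI)
    fix x u assume "(x = n \<or> x \<in> B) \<and> u = 2 * n - k - x"
    then show "1 \<le> u \<and> u \<le> x \<and> x \<le> n" using x[of x] k by auto
  next
    fix x y u v
    assume "(x = n \<or> x \<in> B) \<and> u = 2 * n - k - x" "(y = n \<or> y \<in> B) \<and> v = 2 * n - k - y"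
    then show "\<bar>int x - int y\<bar> = \<bar>int u - int v\<bar>" using x[of x] x[of y] k by auto
  qed
  then show ?thesis using k by (simp add: DDP_fibre_def reflection_eq_Some)
qed

text \<open>If some \<open>x < n\<close> is not translated along with \<open>n\<close>, then its image is the point on the other
  side of \<open>n - k\<close>, and the distance to \<open>x\<close> then forces every other point to be reflected as well.\<close>

lemma fibre_cases:
  assumes k: "k < n" and \<alpha>: "\<alpha> \<in> DDP_fibre n k"
  shows "\<alpha> \<in> translation n k ` Pow {k+1..<n} \<union> reflection n k ` Pow {n - k div 2..<n}"
proof -
  from \<alpha> have D: "\<alpha> \<in> DDP n" and top: "\<alpha> n = Some (n - k)" by (auto simp: DDP_fibre_def)
  have bounds: "1 \<le> u \<and> u \<le> x \<and> x \<le> n" if "\<alpha> x = Some u" for x u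
    using D that by (simp add: DDP_iff)
  have iso: "\<bar>int x - int y\<bar> = \<bar>int u - int v\<bar>" if "\<alpha> x = Some u" "\<alpha> y = Some v" for x y u v
    using D that unfolding DDP_iff by blast
  have image: "u + k = x \<or> u + k + x = 2 * n" if xu: "\<alpha> x = Some u" for x u
    using bounds[OF xu] iso[OF top xu] k by arith
  let ?B = "dom \<alpha> - {n}"
  show ?thesis
  proof (cases "\<forall>x u. \<alpha> x = Some u \<longrightarrow> u + k = x")
    case True
    have "?B \<subseteq> {k+1..<n}"
    proof
      fix x assume "x \<in> ?B"
      then obtain u where xu: "\<alpha> x = Some u" "x \<noteq> n" by auto
      then have "u + k = x" using True by blast
      then show "x \<in> {k+1..<n}" using bounds[OF xu(1)] xu(2) by simp
    qed
    moreover have "\<alpha> = translation n k ?B"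
    proof (rule ext)
      fix x
      show "\<alpha> x = translation n k ?B x"
      proof (cases "\<alpha> x")
        case None
        then have "x \<notin> insert n ?B" using top by auto
        then show ?thesis using None by (simp add: translation_def)
      next
        case (Some u)
        then have "u + k = x" using True by blast
        then have "u = x - k" by simp
        then show ?thesis using Some by (auto simp: translation_def restrict_map_def)
      qed
    qed
    ultimately show ?thesis by blast
  next
    case False
    then obtain z w where zw: "\<alpha> z = Some w" "w + k \<noteq> z" by blast
    have "z \<noteq> n" using zw top k by auto
    then have w: "w + k + z = 2 * n" "z < n"
      using image[OF zw(1)] zw(2) bounds[OF zw(1)] by auto
    have all: "u + k + x = 2 * n" if xu: "\<alpha> x = Some u" for x u
    proof (rule ccontr)
      assume n: "u + k + x \<noteq> 2 * n"
      then have u: "u + k = x" using image[OF xu] by blast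
      then have "x < n" using n bounds[OF xu] by linarith
      then show False using iso[OF zw(1) xu] w u by linarith
    qed
    have "?B \<subseteq> {n - k div 2..<n}"
    proof
      fix x assume "x \<in> ?B"
      then obtain u where xu: "\<alpha> x = Some u" "x \<noteq> n" by auto
      have "2 * n \<le> 2 * x + k" using all[OF xu(1)] bounds[OF xu(1)] by linarith
      then have "n - k div 2 \<le> x" by linarith
      then show "x \<in> {n - k div 2..<n}" using xu bounds[OF xu(1)] by simp
    qed
    moreover have "\<alpha> = reflection n k ?B"
    proof (rule ext)
      fix x
      show "\<alpha> x = reflection n k ?B x"
      proof (cases "\<alpha> x")
        case None
        then have "x \<notin> insert n ?B" using top by auto
        then show ?thesis using None by (simp add: reflection_def)
      next
        case (Some u)
        have "u = 2 * n - k - x" using all[OF Some] by simp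
        then show ?thesis using Some by (auto simp: reflection_def restrict_map_def)
      qed
    qed
    ultimately show ?thesis by blast
  qed
qed

text \<open>The empty set is left out on the reflection side to make the union disjoint.\<close>

lemma DDP_fibre:
  assumes k: "k < n"
  shows "DDP_fibre n k =
    translation n k ` Pow {k+1..<n} \<union> reflection n k ` (Pow {n - k div 2..<n} - {{}})"
    (is "_ = ?T \<union> ?R")
proof
  have reflection: "reflection n k B \<in> ?T \<union> ?R" if "B \<in> Pow {n - k div 2..<n}" for B
  proof (cases "B = {}")
    case True
    then have "reflection n k B = translation n k {}" using reflection_empty k by simp
    then have "reflection n k B \<in> ?T" by (simp add: image_eqI[where x = "{}"])
    then show ?thesis ..
  next
    case False
    with that have "reflection n k B \<in> ?R" by (intro imageI) simp
    then show ?thesis ..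
  qed
  show "DDP_fibre n k \<subseteq> ?T \<union> ?R"
  proof
    fix \<alpha> assume "\<alpha> \<in> DDP_fibre n k"
    from fibre_cases[OF k this] show "\<alpha> \<in> ?T \<union> ?R"
      using reflection by (elim UnE imageE) simp_all
  qed
  show "?T \<union> ?R \<subseteq> DDP_fibre n k"
    using translation_in_fibre[OF k] reflection_in_fibre[OF k]
    by (intro Un_least image_subsetI) simp_all
qed

lemma translation_neq_reflection:
  assumes "B \<subseteq> {k+1..<n}" "C \<subseteq> {n - k div 2..<n}" "C \<noteq> {}"
  shows "translation n k B \<noteq> reflection n k C"
proof
  assume eq: "translation n k B = reflection n k C"
  obtain x where x: "x \<in> C" using assms(3) by blast
  then have "x < n" using assms(2) by auto
  have "reflection n k C x = Some (2 * n - k - x)" using x by (simp add: reflection_eq_Some)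
  then have "x \<in> B" and "2 * n - k - x = x - k"
    using \<open>x < n\<close> by (auto simp: eq[symmetric] translation_eq_Some)
  moreover from \<open>x \<in> B\<close> have "k < x" using assms(1) by auto
  ultimately show False using \<open>x < n\<close> by linarith
qed

lemma finite_DDP_fibre: "k < n \<Longrightarrow> finite (DDP_fibre n k)"
  by (simp add: DDP_fibre)

lemma card_DDP_fibre:
  assumes k: "k < n"
  shows "int (card (DDP_fibre n k)) = 2 ^ (n - Suc k) + 2 ^ (k div 2) - 1"
proof -
  let ?T = "translation n k ` Pow {k+1..<n}"
  let ?R = "reflection n k ` (Pow {n - k div 2..<n} - {{}})"
  have T: "card ?T = 2 ^ (n - Suc k)"
    using card_image[OF inj_on_translation, of n k] by (simp add: card_Pow)
  have "card ?R = card (Pow {n - k div 2..<n} - {{}})"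
    by (rule card_image) (rule inj_on_subset[OF inj_on_reflection], blast)
  also have "\<dots> = 2 ^ card {n - k div 2..<n} - 1"
    by (subst card_Diff_subset) (simp_all add: card_Pow)
  also have "card {n - k div 2..<n} = k div 2" using k by simp
  finally have "card ?R = 2 ^ (k div 2) - 1" .
  moreover have "(1::nat) \<le> 2 ^ (k div 2)" by simp
  ultimately have R: "int (card ?R) = 2 ^ (k div 2) - 1" by (simp add: of_nat_diff)
  have "?T \<inter> ?R = {}" using translation_neq_reflection by auto
  then have "card (?T \<union> ?R) = card ?T + card ?R" by (intro card_Un_disjoint) auto
  then show ?thesis using T R by (simp add: DDP_fibre[OF k])
qed

section \<open>Increments of the order\<close>

lemma finite_DDP: "finite (DDP n)"
  by (induction n) (auto simp: DDP_0 DDP_Suc finite_DDP_fibre)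

text \<open>\<open>increment n\<close> is the closed form of $b_n$.\<close>

definition increment :: "nat \<Rightarrow> int" where
  "increment n = 2 ^ n - 1 - int n + (\<Sum>k<n. 2 ^ (k div 2))"

lemma sum_card_fibres:
  "(\<Sum>k<n. 2 ^ (n - Suc k) + 2 ^ (k div 2) - 1) = increment n"
proof -
  have "(\<Sum>k<n. (2::int) ^ (n - Suc k)) = (\<Sum>k<n. 2 ^ k)"
    by (rule sum.nat_diff_reindex)
  also have "\<dots> = 2 ^ n - 1" by (induction n) auto
  finally show ?thesis by (simp add: increment_def sum.distrib sum_subtractf)
qed

lemma card_DDP_Suc: "int (card (DDP (Suc n))) = int (card (DDP n)) + increment (Suc n)"
proof -
  have disj: "DDP_fibre (Suc n) k \<inter> DDP_fibre (Suc n) l = {}"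
    if "k < Suc n" "l < Suc n" "k \<noteq> l" for k l
    using that by (auto simp: DDP_fibre_def)
  have "card (\<Union>k\<in>{..<Suc n}. DDP_fibre (Suc n) k) = (\<Sum>k<Suc n. card (DDP_fibre (Suc n) k))"
    by (rule card_UN_disjoint) (use disj finite_DDP_fibre in auto)
  also have "int \<dots> = (\<Sum>k<Suc n. 2 ^ (Suc n - Suc k) + 2 ^ (k div 2) - 1)"
    unfolding of_nat_sum by (rule sum.cong) (simp_all only: card_DDP_fibre lessThan_iff)
  also have "\<dots> = increment (Suc n)" by (rule sum_card_fibres)
  finally have fibres: "int (card (\<Union>k\<in>{..<Suc n}. DDP_fibre (Suc n) k)) = increment (Suc n)" .
  have "card (DDP (Suc n)) = card (DDP n) + card (\<Union>k\<in>{..<Suc n}. DDP_fibre (Suc n) k)"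
    unfolding DDP_Suc
  proof (rule card_Un_disjoint)
    show "finite (\<Union>k\<in>{..<Suc n}. DDP_fibre (Suc n) k)"
      by (rule finite_UN_I) (simp_all add: finite_DDP_fibre)
    show "DDP n \<inter> (\<Union>k\<in>{..<Suc n}. DDP_fibre (Suc n) k) = {}"
      using DDP_disjoint_fibre by blast
  qed (rule finite_DDP)
  then show ?thesis using fibres by simp
qed

text \<open>The sum $s_n = \sum_{k<n} 2^{\lfloor k/2\rfloor}$ satisfies
  $s_{n+1} - 2 s_n = 2 - 2^{\lfloor (n+1)/2\rfloor}$.  In the induction step the left-hand side
  grows by $2^{\lfloor (n+1)/2\rfloor} - 2 \cdot 2^{\lfloor n/2\rfloor}$, and
  $2 \cdot 2^{\lfloor n/2\rfloor} = 2^{\lfloor (n+2)/2\rfloor}$.\<close>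

lemma increment_recurrence:
  "increment (Suc n) = 2 * increment n - 2 ^ (Suc n div 2) + int (Suc n) + 1"
proof -
  have "(\<Sum>k<Suc n. 2 ^ (k div 2)) = 2 * (\<Sum>k<n. 2 ^ (k div 2)) + 2 - (2::int) ^ (Suc n div 2)"
    by (induction n) auto
  then show ?thesis by (simp only: increment_def) simp
qed

theorem theorem2p20:
  fixes a :: "int \<Rightarrow> int"
  assumes order: "\<And>n::nat. a (int n) = int (card (DDP n))"
    and initial: "a (-1) = 1"
  shows "a 0 = 1 \<and>
    (\<forall>n::nat. n \<ge> 1 \<longrightarrow>
       a (int n) = 3 * a (int n - 1) - 2 * a (int n - 2) - 2 ^ (n div 2) + int n + 1)"
proof -
  have a0: "a 0 = 1" using order[of 0] by (simp add: DDP_0)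
  have step: "a (int m) = a (int m - 1) + increment m" for m
  proof (cases m)
    case 0
    then show ?thesis using a0 initial by (simp add: increment_def)
  next
    case (Suc l)
    then show ?thesis using order[of m] order[of l] card_DDP_Suc[of l] by simp
  qed
  have "a (int n) = 3 * a (int n - 1) - 2 * a (int n - 2) - 2 ^ (n div 2) + int n + 1"
    if "n \<ge> 1" for n
  proof -
    obtain m where n: "n = Suc m" using \<open>n \<ge> 1\<close> by (cases n) auto
    have "a (int n) = a (int n - 1) + increment n" by (rule step)
    moreover have "a (int n - 1) = a (int n - 2) + increment m" using step[of m] n by simp
    ultimately show ?thesis using increment_recurrence[of m] n by simp
  qed
  with a0 show ?thesis by blast
qed

end
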